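(* Let $\mathcal{D}$ be any triangulated category and $(\Phi_n,\{\Pi_i\}_{i\in\Phi_n})$ a finite t-stability on $\mathcal{D}$. Suppose that for every $i\in\Phi_n$ and all nonzero objects $X,Y\in\Pi_i$ one has $$\mathrm{Hom}(\langle X\rangle,\langle Y\rangle)\neq0\neq\mathrm{Hom}(\langle Y\rangle,\langle X\rangle).$$ Then $(\Phi_n,\{\Pi_i\}_{i\in\Phi_n})$ is finite finest.
   Context: All categories are $\mathbf{k}$-linear over a fixed algebraically closed field $\mathbf{k}$. $\Phi_n=\{1<2<\dots<n\}$. $\langle\mathcal{S}\rangle$ is the full triangulated subcategory generated by $\mathcal{S}$, closed under extensions, direct summands and shifts. For subcategories $\mathcal{A},\mathcal{B}$, $\mathrm{Hom}(\mathcal{A},\mathcal{B})\ne0$ means that $\mathrm{Hom}(A,B)\neq0$ for some $A\in\mathcal{A}$, $B\in\mathcal{B}$. t-stability on $\mathcal{D}$: a linearly ordered set $\Phi$ together with a strictly full extension-closed nonzero subcategory $\Pi_\varphi\subset\mathcal{D}$ for every $\varphi\in\Phi$, such that (1) there is an order automorphism $\tau_\Phi$ of $\Phi$ with $\Pi_{\tau_\Phi(\varphi)}=\Pi_\varphi[1]$ and $\tau_\Phi(\varphi)\ge\varphi$ for all $\varphi$; (2) $\mathrm{Hom}^{\le0}(\Pi_{\varphi'},\Pi_{\varphi''})=0$ for all $\varphi'>\varphi''$; (3) every nonzero $X\in\mathcal{D}$ admits a finite sequence of morphisms $0=X_n\xrightarrow{p_n}X_{n-1}\to\dots\xrightarrow{p_1}X_0=X$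 with nonzero cones $A_i=\mathrm{cone}(p_i)\in\Pi_{\varphi_i}$ and $\varphi_{i+1}>\varphi_i$ for all $i$. It is finite if $\Phi$ is finite (then $\tau_\Phi=\mathrm{id}$ and each $\Pi_\varphi$ is a triangulated subcategory). Two t-stabilities $(\Phi,\{\Pi_\varphi\})$, $(\Psi,\{P_\psi\})$ are equivalent if there is an order-preserving bijection $r:\Phi\to\Psi$ with $P_{r(\varphi)}=\Pi_\varphi$ for all $\varphi$; finite t-stabilities are considered up to equivalence. Finer: a finite t-stability $(\Psi,\{P_\psi\})$ is finer than $(\Phi,\{\Pi_\varphi\})$ if there is a surjective map $r:\Psi\to\Phi$ with $r\tau_\Psi=\tau_\Phi r$, $\psi'>\psi''\Rightarrow r(\psi')\ge r(\psi'')$, and $\Pi_\varphi=\langle P_\psi\mid\psi\in r^{-1}(\varphi)\rangle$ for all $\varphi$. Finite finest t-stabilities are the minimal elements for this partial order (any finite t-stability finer than it is equivalent to it). *)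

theory Defs
  imports "HOL-Algebra.Algebraic_Closure" "HOL.Hull"
begin

section \<open>Linear categories\<close>

text \<open>
  Morphism spaces are modules in the sense of HOL-Algebra; the ring fields \<open>mult\<close> and \<open>one\<close> that
  the record \<^type>\<open>module\<close> inherits are not used. Morphisms carry no source and
  target, and composition and (below) the shift of morphisms are not indexed by objects. This is no
  restriction, since a morphism may be tagged with its source and target; conversely, morphism
  spaces of different pairs of objects are not required to be disjoint.
\<close>

record ('o, 'm, 'k) lin_cat =
  Ob :: "'o set"
  Hom :: "'o \<Rightarrow> 'o \<Rightarrow> ('k, 'm) module"
  idm :: "'o \<Rightarrow> 'm"
  cmp :: "'m \<Rightarrow> 'm \<Rightarrow> 'm"  (infixl \<open>\<cdot>\<index>\<close> 70)

abbreviation Arr :: "('o, 'm, 'k, 'e) lin_cat_scheme \<Rightarrow> 'o \<Rightarrow> 'o \<Rightarrow> 'm set" where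
  "Arr D U V \<equiv> carrier (Hom D U V)"

locale linear_category = algebraically_closed K
  for K :: "('k, 'a) ring_scheme" (structure) +
  fixes D :: "('o, 'm, 'k, 'e) lin_cat_scheme"
  assumes Hom_module: "\<lbrakk>U \<in> Ob D; V \<in> Ob D\<rbrakk> \<Longrightarrow> module K (Hom D U V)"
    and idm_in: "U \<in> Ob D \<Longrightarrow> idm D U \<in> Arr D U U"
    and cmp_in: "\<lbrakk>U \<in> Ob D; V \<in> Ob D; W \<in> Ob D; f \<in> Arr D U V; g \<in> Arr D V W\<rbrakk>
      \<Longrightarrow> g \<cdot>\<^bsub>D\<^esub> f \<in> Arr D U W"
    and cmp_assoc: "\<lbrakk>T \<in> Ob D; U \<in> Ob D; V \<in> Ob D; W \<in> Ob D;
        f \<in> Arr D T U; g \<in> Arr D U V; h \<in> Arr D V W\<rbrakk>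
      \<Longrightarrow> (h \<cdot>\<^bsub>D\<^esub> g) \<cdot>\<^bsub>D\<^esub> f = h \<cdot>\<^bsub>D\<^esub> (g \<cdot>\<^bsub>D\<^esub> f)"
    and cmp_idm_right: "\<lbrakk>U \<in> Ob D; V \<in> Ob D; f \<in> Arr D U V\<rbrakk> \<Longrightarrow> f \<cdot>\<^bsub>D\<^esub> idm D U = f"
    and cmp_idm_left: "\<lbrakk>U \<in> Ob D; V \<in> Ob D; f \<in> Arr D U V\<rbrakk> \<Longrightarrow> idm D V \<cdot>\<^bsub>D\<^esub> f = f"
    and cmp_add_right: "\<lbrakk>U \<in> Ob D; V \<in> Ob D; W \<in> Ob D;
        f \<in> Arr D U V; f' \<in> Arr D U V; g \<in> Arr D V W\<rbrakk>
      \<Longrightarrow> g \<cdot>\<^bsub>D\<^esub> (f \<oplus>\<^bsub>Hom D U V\<^esub> f') = g \<cdot>\<^bsub>D\<^esub> f \<oplus>\<^bsub>Hom D U W\<^esub> g \<cdot>\<^bsub>D\<^esub> f'"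
    and cmp_add_left: "\<lbrakk>U \<in> Ob D; V \<in> Ob D; W \<in> Ob D;
        f \<in> Arr D U V; g \<in> Arr D V W; g' \<in> Arr D V W\<rbrakk>
      \<Longrightarrow> (g \<oplus>\<^bsub>Hom D V W\<^esub> g') \<cdot>\<^bsub>D\<^esub> f = g \<cdot>\<^bsub>D\<^esub> f \<oplus>\<^bsub>Hom D U W\<^esub> g' \<cdot>\<^bsub>D\<^esub> f"
    and cmp_smult_right: "\<lbrakk>U \<in> Ob D; V \<in> Ob D; W \<in> Ob D; \<alpha> \<in> carrier K;
        f \<in> Arr D U V; g \<in> Arr D V W\<rbrakk>
      \<Longrightarrow> g \<cdot>\<^bsub>D\<^esub> (\<alpha> \<odot>\<^bsub>Hom D U V\<^esub> f) = \<alpha> \<odot>\<^bsub>Hom D U W\<^esub> (g \<cdot>\<^bsub>D\<^esub> f)"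
    and cmp_smult_left: "\<lbrakk>U \<in> Ob D; V \<in> Ob D; W \<in> Ob D; \<alpha> \<in> carrier K;
        f \<in> Arr D U V; g \<in> Arr D V W\<rbrakk>
      \<Longrightarrow> (\<alpha> \<odot>\<^bsub>Hom D V W\<^esub> g) \<cdot>\<^bsub>D\<^esub> f = \<alpha> \<odot>\<^bsub>Hom D U W\<^esub> (g \<cdot>\<^bsub>D\<^esub> f)"

definition iso_arr :: "('o, 'm, 'k, 'e) lin_cat_scheme \<Rightarrow> 'o \<Rightarrow> 'o \<Rightarrow> 'm \<Rightarrow> bool" where
  "iso_arr D U V f \<longleftrightarrow> f \<in> Arr D U V \<and>
     (\<exists>g \<in> Arr D V U. g \<cdot>\<^bsub>D\<^esub> f = idm D U \<and> f \<cdot>\<^bsub>D\<^esub> g = idm D V)"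

definition isomorphic :: "('o, 'm, 'k, 'e) lin_cat_scheme \<Rightarrow> 'o \<Rightarrow> 'o \<Rightarrow> bool" where
  "isomorphic D U V \<longleftrightarrow> U \<in> Ob D \<and> V \<in> Ob D \<and> (\<exists>f. iso_arr D U V f)"

definition zero_obj :: "('o, 'm, 'k, 'e) lin_cat_scheme \<Rightarrow> 'o \<Rightarrow> bool" where
  "zero_obj D U \<longleftrightarrow> U \<in> Ob D \<and>
     (\<forall>V \<in> Ob D. Arr D U V = {\<zero>\<^bsub>Hom D U V\<^esub>} \<and> Arr D V U = {\<zero>\<^bsub>Hom D V U\<^esub>})"

definition biproduct :: "('o, 'm, 'k, 'e) lin_cat_scheme \<Rightarrow> 'o \<Rightarrow> 'o \<Rightarrow> 'o \<Rightarrow> bool" where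
  "biproduct D U W V \<longleftrightarrow> U \<in> Ob D \<and> W \<in> Ob D \<and> V \<in> Ob D \<and>
     (\<exists>i \<in> Arr D U V. \<exists>p \<in> Arr D V U. \<exists>j \<in> Arr D W V. \<exists>q \<in> Arr D V W.
        p \<cdot>\<^bsub>D\<^esub> i = idm D U \<and> q \<cdot>\<^bsub>D\<^esub> j = idm D W \<and>
        (i \<cdot>\<^bsub>D\<^esub> p) \<oplus>\<^bsub>Hom D V V\<^esub> (j \<cdot>\<^bsub>D\<^esub> q) = idm D V)"


section \<open>Triangulated categories\<close>

text \<open>
  A member \<open>(U, V, W, f, g, h)\<close> of \<open>tri\<close> is a distinguished triangle with maps \<open>f\<close> from \<open>U\<close> to \<open>V\<close>,
  \<open>g\<close> from \<open>V\<close> to \<open>W\<close> and \<open>h\<close> from \<open>W\<close> to \<open>U[1]\<close>.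
\<close>

record ('o, 'm, 'k) tri_cat = "('o, 'm, 'k) lin_cat" +
  shO :: "'o \<Rightarrow> 'o"
  shM :: "'m \<Rightarrow> 'm"
  tri :: "('o \<times> 'o \<times> 'o \<times> 'm \<times> 'm \<times> 'm) set"

text \<open>
  The shift is only required to be a linear auto-equivalence, which includes the convention that it
  is an automorphism.
\<close>

locale triangulated_category = linear_category K D
  for K :: "('k, 'a) ring_scheme" (structure) and D :: "('o, 'm, 'k, 'e) tri_cat_scheme" +
  assumes zero_obj_exists: "\<exists>W. zero_obj D W"
    and biproduct_exists: "\<lbrakk>U \<in> Ob D; V \<in> Ob D\<rbrakk> \<Longrightarrow> \<exists>S. biproduct D U V S"
    and shO_in: "U \<in> Ob D \<Longrightarrow> shO D U \<in> Ob D"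
    and shM_idm: "U \<in> Ob D \<Longrightarrow> shM D (idm D U) = idm D (shO D U)"
    and shM_cmp: "\<lbrakk>U \<in> Ob D; V \<in> Ob D; W \<in> Ob D; f \<in> Arr D U V; g \<in> Arr D V W\<rbrakk>
      \<Longrightarrow> shM D (g \<cdot>\<^bsub>D\<^esub> f) = shM D g \<cdot>\<^bsub>D\<^esub> shM D f"
    and shM_bij: "\<lbrakk>U \<in> Ob D; V \<in> Ob D\<rbrakk>
      \<Longrightarrow> bij_betw (shM D) (Arr D U V) (Arr D (shO D U) (shO D V))"
    and shM_add: "\<lbrakk>U \<in> Ob D; V \<in> Ob D; f \<in> Arr D U V; g \<in> Arr D U V\<rbrakk>
      \<Longrightarrow> shM D (f \<oplus>\<^bsub>Hom D U V\<^esub> g) = shM D f \<oplus>\<^bsub>Hom D (shO D U) (shO D V)\<^esub> shM D g"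
    and shM_smult: "\<lbrakk>U \<in> Ob D; V \<in> Ob D; \<alpha> \<in> carrier K; f \<in> Arr D U V\<rbrakk>
      \<Longrightarrow> shM D (\<alpha> \<odot>\<^bsub>Hom D U V\<^esub> f) = \<alpha> \<odot>\<^bsub>Hom D (shO D U) (shO D V)\<^esub> shM D f"
    and shO_ess_surj: "V \<in> Ob D \<Longrightarrow> \<exists>U \<in> Ob D. isomorphic D (shO D U) V"
    and tri_typed: "(U, V, W, f, g, h) \<in> tri D \<Longrightarrow> U \<in> Ob D \<and> V \<in> Ob D \<and> W \<in> Ob D \<and>
        f \<in> Arr D U V \<and> g \<in> Arr D V W \<and> h \<in> Arr D W (shO D U)"
    and TR1_iso: "\<lbrakk>(U, V, W, f, g, h) \<in> tri D; U' \<in> Ob D; V' \<in> Ob D; W' \<in> Ob D;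
        f' \<in> Arr D U' V'; g' \<in> Arr D V' W'; h' \<in> Arr D W' (shO D U');
        iso_arr D U U' a; iso_arr D V V' b; iso_arr D W W' c;
        b \<cdot>\<^bsub>D\<^esub> f = f' \<cdot>\<^bsub>D\<^esub> a; c \<cdot>\<^bsub>D\<^esub> g = g' \<cdot>\<^bsub>D\<^esub> b; shM D a \<cdot>\<^bsub>D\<^esub> h = h' \<cdot>\<^bsub>D\<^esub> c\<rbrakk>
      \<Longrightarrow> (U', V', W', f', g', h') \<in> tri D"
    and TR1_id: "\<lbrakk>U \<in> Ob D; zero_obj D W\<rbrakk>
      \<Longrightarrow> (U, U, W, idm D U, \<zero>\<^bsub>Hom D U W\<^esub>, \<zero>\<^bsub>Hom D W (shO D U)\<^esub>) \<in> tri D"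
    and TR1_cone: "\<lbrakk>U \<in> Ob D; V \<in> Ob D; f \<in> Arr D U V\<rbrakk>
      \<Longrightarrow> \<exists>W g h. (U, V, W, f, g, h) \<in> tri D"
    and TR2: "\<lbrakk>U \<in> Ob D; V \<in> Ob D; W \<in> Ob D;
        f \<in> Arr D U V; g \<in> Arr D V W; h \<in> Arr D W (shO D U)\<rbrakk>
      \<Longrightarrow> (U, V, W, f, g, h) \<in> tri D \<longleftrightarrow>
          (V, W, shO D U, g, h, \<ominus>\<^bsub>Hom D (shO D U) (shO D V)\<^esub> shM D f) \<in> tri D"
    and TR3: "\<lbrakk>(U, V, W, f, g, h) \<in> tri D; (U', V', W', f', g', h') \<in> tri D;
        a \<in> Arr D U U'; b \<in> Arr D V V'; b \<cdot>\<^bsub>D\<^esub> f = f' \<cdot>\<^bsub>D\<^esub> a\<rbrakk>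
      \<Longrightarrow> \<exists>c \<in> Arr D W W'. c \<cdot>\<^bsub>D\<^esub> g = g' \<cdot>\<^bsub>D\<^esub> b \<and> shM D a \<cdot>\<^bsub>D\<^esub> h = h' \<cdot>\<^bsub>D\<^esub> c"
    and TR4: "\<lbrakk>(U, V, Q1, f, p1, d1) \<in> tri D; (U, W, Q2, g \<cdot>\<^bsub>D\<^esub> f, p2, d2) \<in> tri D;
        (V, W, Q3, g, p3, d3) \<in> tri D\<rbrakk>
      \<Longrightarrow> \<exists>u \<in> Arr D Q1 Q2. \<exists>v \<in> Arr D Q2 Q3.
          (Q1, Q2, Q3, u, v, shM D p1 \<cdot>\<^bsub>D\<^esub> d3) \<in> tri D \<and>
          u \<cdot>\<^bsub>D\<^esub> p1 = p2 \<cdot>\<^bsub>D\<^esub> g \<and> d2 \<cdot>\<^bsub>D\<^esub> u = d1 \<and>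
          v \<cdot>\<^bsub>D\<^esub> p2 = p3 \<and> d3 \<cdot>\<^bsub>D\<^esub> v = shM D f \<cdot>\<^bsub>D\<^esub> d2"

definition unshift :: "('o, 'm, 'k, 'e) tri_cat_scheme \<Rightarrow> 'o \<Rightarrow> 'o" where
  "unshift D V = (SOME U. U \<in> Ob D \<and> isomorphic D (shO D U) V)"

text \<open>The object \<open>U[i]\<close>; for negative \<open>i\<close> it is a choice within its isomorphism class.\<close>

definition shift :: "('o, 'm, 'k, 'e) tri_cat_scheme \<Rightarrow> int \<Rightarrow> 'o \<Rightarrow> 'o" where
  "shift D i U = (if 0 \<le> i then (shO D ^^ nat i) U else (unshift D ^^ nat (- i)) U)"


section \<open>Strictly full subcategories\<close>

text \<open>A strictly full subcategory is represented by its set of objects.\<close>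

definition strictly_full :: "('o, 'm, 'k, 'e) lin_cat_scheme \<Rightarrow> 'o set \<Rightarrow> bool" where
  "strictly_full D A \<longleftrightarrow> A \<subseteq> Ob D \<and> (\<forall>U \<in> A. \<forall>V. isomorphic D U V \<longrightarrow> V \<in> A)"

definition extension_closed :: "('o, 'm, 'k, 'e) tri_cat_scheme \<Rightarrow> 'o set \<Rightarrow> bool" where
  "extension_closed D A \<longleftrightarrow>
     (\<forall>U V W f g h. (U, V, W, f, g, h) \<in> tri D \<and> U \<in> A \<and> W \<in> A \<longrightarrow> V \<in> A)"

definition summand_closed :: "('o, 'm, 'k, 'e) lin_cat_scheme \<Rightarrow> 'o set \<Rightarrow> bool" where
  "summand_closed D A \<longleftrightarrow> (\<forall>U W V. biproduct D U W V \<and> V \<in> A \<longrightarrow> U \<in> A)"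

text \<open>
  In a strictly full subcategory, the equivalence below says closure under shifts in both
  directions.
\<close>

definition shift_closed :: "('o, 'm, 'k, 'e) tri_cat_scheme \<Rightarrow> 'o set \<Rightarrow> bool" where
  "shift_closed D A \<longleftrightarrow> (\<forall>U \<in> Ob D. shO D U \<in> A \<longleftrightarrow> U \<in> A)"

text \<open>
  Closure under cones follows from closure under extensions and shifts by rotating triangles, so
  thick subcategories are triangulated.
\<close>

definition thick :: "('o, 'm, 'k, 'e) tri_cat_scheme \<Rightarrow> 'o set \<Rightarrow> bool" where
  "thick D A \<longleftrightarrow> strictly_full D A \<and> (\<forall>W. zero_obj D W \<longrightarrow> W \<in> A) \<and>
     shift_closed D A \<and> extension_closed D A \<and> summand_closed D A"

definition generated :: "('o, 'm, 'k, 'e) tri_cat_scheme \<Rightarrow> 'o set \<Rightarrow> 'o set" where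
  "generated D S = thick D hull S"

definition Hom_nonzero :: "('o, 'm, 'k, 'e) lin_cat_scheme \<Rightarrow> 'o set \<Rightarrow> 'o set \<Rightarrow> bool" where
  "Hom_nonzero D A B \<longleftrightarrow> (\<exists>U \<in> A. \<exists>V \<in> B. Arr D U V \<noteq> {\<zero>\<^bsub>Hom D U V\<^esub>})"

text \<open>
  \<open>A[1]\<close>, closed under isomorphisms: if the shift is not an automorphism, the image of a strictly
  full subcategory need not be strictly full.
\<close>

definition shift_subcat :: "('o, 'm, 'k, 'e) tri_cat_scheme \<Rightarrow> 'o set \<Rightarrow> 'o set" where
  "shift_subcat D A = {V. \<exists>U \<in> A. isomorphic D (shO D U) V}"


section \<open>t-stabilities\<close>

text \<open>
  The linearly ordered index set is a subset \<open>\<Phi>\<close> of a linearly ordered type; the values of \<open>P\<close> and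
  \<open>\<tau>\<close> outside \<open>\<Phi>\<close> are irrelevant.
\<close>

definition shift_automorphism ::
    "('o, 'm, 'k, 'e) tri_cat_scheme \<Rightarrow> 'i::linorder set \<Rightarrow> ('i \<Rightarrow> 'o set) \<Rightarrow> ('i \<Rightarrow> 'i) \<Rightarrow> bool" where
  "shift_automorphism D \<Phi> P \<tau> \<longleftrightarrow> bij_betw \<tau> \<Phi> \<Phi> \<and> strict_mono_on \<Phi> \<tau> \<and>
     (\<forall>\<phi> \<in> \<Phi>. P (\<tau> \<phi>) = shift_subcat D (P \<phi>) \<and> \<phi> \<le> \<tau> \<phi>)"

definition filtration ::
    "('o, 'm, 'k, 'e) tri_cat_scheme \<Rightarrow> 'i::linorder set \<Rightarrow> ('i \<Rightarrow> 'o set) \<Rightarrow> 'o \<Rightarrow>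
     nat \<Rightarrow> (nat \<Rightarrow> 'o) \<Rightarrow> (nat \<Rightarrow> 'm) \<Rightarrow> (nat \<Rightarrow> 'o) \<Rightarrow> (nat \<Rightarrow> 'i) \<Rightarrow> bool" where
  "filtration D \<Phi> P U n Us p A \<phi> \<longleftrightarrow> Us 0 = U \<and> zero_obj D (Us n) \<and>
     (\<forall>i \<in> {1..n}. (\<exists>g h. (Us i, Us (i - 1), A i, p i, g, h) \<in> tri D) \<and>
        \<not> zero_obj D (A i) \<and> \<phi> i \<in> \<Phi> \<and> A i \<in> P (\<phi> i)) \<and>
     (\<forall>i \<in> {1..<n}. \<phi> i < \<phi> (i + 1))"

definition t_stability ::
    "('o, 'm, 'k, 'e) tri_cat_scheme \<Rightarrow> 'i::linorder set \<Rightarrow> ('i \<Rightarrow> 'o set) \<Rightarrow> bool" where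
  "t_stability D \<Phi> P \<longleftrightarrow>
     (\<forall>\<phi> \<in> \<Phi>. strictly_full D (P \<phi>) \<and> extension_closed D (P \<phi>) \<and>
        (\<exists>U \<in> P \<phi>. \<not> zero_obj D U)) \<and>
     (\<exists>\<tau>. shift_automorphism D \<Phi> P \<tau>) \<and>
     (\<forall>\<phi>' \<in> \<Phi>. \<forall>\<phi>'' \<in> \<Phi>. \<phi>' > \<phi>'' \<longrightarrow>
        (\<forall>i \<le> 0. \<forall>U \<in> P \<phi>'. \<forall>V \<in> P \<phi>''.
           Arr D U (shift D i V) = {\<zero>\<^bsub>Hom D U (shift D i V)\<^esub>})) \<and>
     (\<forall>U \<in> Ob D. \<not> zero_obj D U \<longrightarrow> (\<exists>n Us p A \<phi>. filtration D \<Phi> P U n Us p A \<phi>))"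

definition finite_t_stability ::
    "('o, 'm, 'k, 'e) tri_cat_scheme \<Rightarrow> 'i::linorder set \<Rightarrow> ('i \<Rightarrow> 'o set) \<Rightarrow> bool" where
  "finite_t_stability D \<Phi> P \<longleftrightarrow> t_stability D \<Phi> P \<and> finite \<Phi>"

definition t_stability_equiv ::
    "'i::linorder set \<Rightarrow> ('i \<Rightarrow> 'o set) \<Rightarrow> 'j::linorder set \<Rightarrow> ('j \<Rightarrow> 'o set) \<Rightarrow> bool" where
  "t_stability_equiv \<Phi> P \<Psi> Q \<longleftrightarrow>
     (\<exists>r. bij_betw r \<Phi> \<Psi> \<and> mono_on \<Phi> r \<and> (\<forall>\<phi> \<in> \<Phi>. Q (r \<phi>) = P \<phi>))"

text \<open>
  \<open>finer D \<Psi> Q \<Phi> P\<close> says that \<open>(\<Psi>, Q)\<close> is finer than \<open>(\<Phi>, P)\<close>. The automorphism \<open>\<tau>\<close> of a t-stability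
  is unique on the index set because the \<open>P \<phi>\<close> are nonzero and pairwise orthogonal, hence pairwise
  distinct; so it does not matter that \<open>\<tau>\<Psi>\<close> and \<open>\<tau>\<Phi>\<close> are existentially quantified.
\<close>

definition finer ::
    "('o, 'm, 'k, 'e) tri_cat_scheme \<Rightarrow> 'j::linorder set \<Rightarrow> ('j \<Rightarrow> 'o set) \<Rightarrow>
     'i::linorder set \<Rightarrow> ('i \<Rightarrow> 'o set) \<Rightarrow> bool" where
  "finer D \<Psi> Q \<Phi> P \<longleftrightarrow>
     (\<exists>r \<tau>\<Psi> \<tau>\<Phi>. shift_automorphism D \<Psi> Q \<tau>\<Psi> \<and> shift_automorphism D \<Phi> P \<tau>\<Phi> \<and>
        r ` \<Psi> = \<Phi> \<and>
        (\<forall>\<psi> \<in> \<Psi>. r (\<tau>\<Psi> \<psi>) = \<tau>\<Phi> (r \<psi>)) \<and>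
        (\<forall>\<psi>' \<in> \<Psi>. \<forall>\<psi>'' \<in> \<Psi>. \<psi>' > \<psi>'' \<longrightarrow> r \<psi>' \<ge> r \<psi>'') \<and>
        (\<forall>\<phi> \<in> \<Phi>. P \<phi> = generated D (\<Union>\<psi> \<in> {\<psi> \<in> \<Psi>. r \<psi> = \<phi>}. Q \<psi>)))"

text \<open>
  A definition cannot quantify over index types, so the competitors \<open>(\<Psi>, Q)\<close> are indexed by finite
  sets of natural numbers. Every finite linearly ordered set is order isomorphic to one of these,
  and both \<^const>\<open>finer\<close> and \<^const>\<open>t_stability_equiv\<close> are invariant under reindexing along an order
  isomorphism.
\<close>

definition finite_finest ::
    "('o, 'm, 'k, 'e) tri_cat_scheme \<Rightarrow> 'i::linorder set \<Rightarrow> ('i \<Rightarrow> 'o set) \<Rightarrow> bool" where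
  "finite_finest D \<Phi> P \<longleftrightarrow> finite_t_stability D \<Phi> P \<and>
     (\<forall>(\<Psi> :: nat set) Q. finite_t_stability D \<Psi> Q \<and> finer D \<Psi> Q \<Phi> P
        \<longrightarrow> t_stability_equiv \<Psi> Q \<Phi> P)"

end

theory Submission
  imports Defs
begin

text \<open>
  On a finite index set the automorphism of a t-stability is the identity, so every slice is closed
  under shifts, and the orthogonals of unions of slices are thick. The first quotient of a
  filtration shows that a slice is the intersection of the left orthogonal of the lower slices with
  the right orthogonal of the upper ones; hence slices are thick. If a refinement sent two indices
  to the same one, nonzero objects of the two orthogonal thick slices would violate the
  Hom condition. So the map of indices is bijective, and each slice, being the subcategory
  generated by a single thick slice of the refinement, agrees with it.
\<close>

section \<open>Zero morphisms, zero objects and retracts in a linear category\<close>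

context linear_category
begin

lemma Hom_abelian_group: "\<lbrakk>U \<in> Ob D; V \<in> Ob D\<rbrakk> \<Longrightarrow> abelian_group (Hom D U V)"
  using Hom_module by (simp add: module_def)

lemma zero_in [simp]: "\<lbrakk>U \<in> Ob D; V \<in> Ob D\<rbrakk> \<Longrightarrow> \<zero>\<^bsub>Hom D U V\<^esub> \<in> Arr D U V"
  using abelian_group.axioms(1)[OF Hom_abelian_group] by (rule abelian_monoid.zero_closed)

lemma idempotent_imp_zero:
  assumes "U \<in> Ob D" "V \<in> Ob D" "x \<in> Arr D U V" "x \<oplus>\<^bsub>Hom D U V\<^esub> x = x"
  shows "x = \<zero>\<^bsub>Hom D U V\<^esub>"
proof -
  interpret M: abelian_group "Hom D U V" using Hom_abelian_group assms(1,2) .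
  show ?thesis using assms(3,4) by (metis M.add.l_cancel_one')
qed

lemma zero_add_zero:
  assumes "U \<in> Ob D" "V \<in> Ob D"
  shows "\<zero>\<^bsub>Hom D U V\<^esub> \<oplus>\<^bsub>Hom D U V\<^esub> \<zero>\<^bsub>Hom D U V\<^esub> = \<zero>\<^bsub>Hom D U V\<^esub>"
proof -
  interpret M: abelian_group "Hom D U V" using Hom_abelian_group assms .
  show ?thesis by simp
qed

lemma cmp_zero_right:
  assumes "U \<in> Ob D" "V \<in> Ob D" "W \<in> Ob D" "g \<in> Arr D V W"
  shows "g \<cdot>\<^bsub>D\<^esub> \<zero>\<^bsub>Hom D U V\<^esub> = \<zero>\<^bsub>Hom D U W\<^esub>"
  using cmp_add_right[OF assms(1-3) zero_in zero_in assms(4)] assms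
  by (intro idempotent_imp_zero) (auto intro: cmp_in simp: zero_add_zero)

lemma cmp_zero_left:
  assumes "U \<in> Ob D" "V \<in> Ob D" "W \<in> Ob D" "f \<in> Arr D U V"
  shows "\<zero>\<^bsub>Hom D V W\<^esub> \<cdot>\<^bsub>D\<^esub> f = \<zero>\<^bsub>Hom D U W\<^esub>"
  using cmp_add_left[OF assms(1-3) assms(4) zero_in zero_in] assms
  by (intro idempotent_imp_zero) (auto intro: cmp_in simp: zero_add_zero)

lemma cmp_minus_right:
  assumes "U \<in> Ob D" "V \<in> Ob D" "W \<in> Ob D" "f \<in> Arr D U V" "g \<in> Arr D V W"
  shows "g \<cdot>\<^bsub>D\<^esub> (\<ominus>\<^bsub>Hom D U V\<^esub> f) = \<ominus>\<^bsub>Hom D U W\<^esub> (g \<cdot>\<^bsub>D\<^esub> f)"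
proof -
  interpret UV: abelian_group "Hom D U V" using Hom_abelian_group assms(1,2) .
  interpret UW: abelian_group "Hom D U W" using Hom_abelian_group assms(1,3) .
  have "g \<cdot>\<^bsub>D\<^esub> (\<ominus>\<^bsub>Hom D U V\<^esub> f) \<oplus>\<^bsub>Hom D U W\<^esub> g \<cdot>\<^bsub>D\<^esub> f = \<zero>\<^bsub>Hom D U W\<^esub>"
    using assms cmp_add_right[of U V W "\<ominus>\<^bsub>Hom D U V\<^esub> f" f g]
    by (simp add: UV.l_neg cmp_zero_right)
  then show ?thesis
    using assms UV.a_inv_closed[OF assms(4)] by (intro UW.minus_equality[symmetric]) (auto intro: cmp_in)
qed

lemma hom_zeroI:
  assumes "U \<in> Ob D" "V \<in> Ob D" "\<And>f. f \<in> Arr D U V \<Longrightarrow> f = \<zero>\<^bsub>Hom D U V\<^esub>"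
  shows "Arr D U V = {\<zero>\<^bsub>Hom D U V\<^esub>}"
  using assms by (auto intro: zero_in)

text \<open>The identity of \<open>U\<close> is then zero, and every map from or to \<open>U\<close>
  factors through it. The orthogonality arguments end here: an object lying in a subcategory and in
  its orthogonal has no nonzero endomorphism.\<close>

lemma zero_objI:
  assumes "U \<in> Ob D" "Arr D U U = {\<zero>\<^bsub>Hom D U U\<^esub>}"
  shows "zero_obj D U"
  unfolding zero_obj_def
proof (intro conjI ballI)
  have id0: "idm D U = \<zero>\<^bsub>Hom D U U\<^esub>" using assms idm_in by blast
  fix V assume V: "V \<in> Ob D"
  show "Arr D U V = {\<zero>\<^bsub>Hom D U V\<^esub>}"
    using assms V id0 cmp_idm_right[of U V] cmp_zero_right[of U U V] by (intro hom_zeroI) auto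
  show "Arr D V U = {\<zero>\<^bsub>Hom D V U\<^esub>}"
    using assms V id0 cmp_idm_left[of V U] cmp_zero_left[of V U U] by (intro hom_zeroI) auto
qed (fact assms(1))

lemma isomorphicE:
  assumes "isomorphic D U V"
  obtains f g where "U \<in> Ob D" "V \<in> Ob D" "f \<in> Arr D U V" "g \<in> Arr D V U"
    "g \<cdot>\<^bsub>D\<^esub> f = idm D U" "f \<cdot>\<^bsub>D\<^esub> g = idm D V"
  using assms unfolding isomorphic_def iso_arr_def by blast

lemma isomorphic_sym: "isomorphic D U V \<Longrightarrow> isomorphic D V U"
  unfolding isomorphic_def iso_arr_def by blast

text \<open>A map into \<open>U\<close> is recovered from its composite with \<open>i\<close> by
  applying \<open>p\<close>. Since only \<open>p\<close> after \<open>i\<close> has to be an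
  identity, this covers direct summands and isomorphic objects alike.\<close>

lemma hom_zero_retract_target:
  assumes "T \<in> Ob D" "U \<in> Ob D" "V \<in> Ob D" "i \<in> Arr D U V" "p \<in> Arr D V U"
    and "p \<cdot>\<^bsub>D\<^esub> i = idm D U" "Arr D T V = {\<zero>\<^bsub>Hom D T V\<^esub>}"
  shows "Arr D T U = {\<zero>\<^bsub>Hom D T U\<^esub>}"
proof (rule hom_zeroI)
  fix f assume f: "f \<in> Arr D T U"
  have "i \<cdot>\<^bsub>D\<^esub> f = \<zero>\<^bsub>Hom D T V\<^esub>" using cmp_in[of T U V f i] assms f by blast
  then have "\<zero>\<^bsub>Hom D T U\<^esub> = p \<cdot>\<^bsub>D\<^esub> (i \<cdot>\<^bsub>D\<^esub> f)"
    using assms by (simp add: cmp_zero_right)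
  also have "\<dots> = f"
    using assms f cmp_assoc[of T U V U f i p] by (simp add: cmp_idm_left)
  finally show "f = \<zero>\<^bsub>Hom D T U\<^esub>" ..
qed (use assms in auto)

lemma hom_zero_retract_source:
  assumes "T \<in> Ob D" "U \<in> Ob D" "V \<in> Ob D" "i \<in> Arr D U V" "p \<in> Arr D V U"
    and "p \<cdot>\<^bsub>D\<^esub> i = idm D U" "Arr D V T = {\<zero>\<^bsub>Hom D V T\<^esub>}"
  shows "Arr D U T = {\<zero>\<^bsub>Hom D U T\<^esub>}"
proof (rule hom_zeroI)
  fix f assume f: "f \<in> Arr D U T"
  have "f \<cdot>\<^bsub>D\<^esub> p = \<zero>\<^bsub>Hom D V T\<^esub>" using cmp_in[of V U T p f] assms f by blast
  then have "\<zero>\<^bsub>Hom D U T\<^esub> = (f \<cdot>\<^bsub>D\<^esub> p) \<cdot>\<^bsub>D\<^esub> i"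
    using assms by (simp add: cmp_zero_left)
  also have "\<dots> = f"
    using assms f cmp_assoc[of U V U T i p f] by (simp add: cmp_idm_right)
  finally show "f = \<zero>\<^bsub>Hom D U T\<^esub>" ..
qed (use assms in auto)

lemma hom_zero_isomorphic_target:
  assumes "isomorphic D U V" "T \<in> Ob D" "Arr D T U = {\<zero>\<^bsub>Hom D T U\<^esub>}"
  shows "Arr D T V = {\<zero>\<^bsub>Hom D T V\<^esub>}"
  using assms(1) by (rule isomorphicE) (rule hom_zero_retract_target[of T V U]; use assms in simp)

lemma hom_zero_isomorphic_source:
  assumes "isomorphic D U V" "T \<in> Ob D" "Arr D U T = {\<zero>\<^bsub>Hom D U T\<^esub>}"
  shows "Arr D V T = {\<zero>\<^bsub>Hom D V T\<^esub>}"
  using assms(1) by (rule isomorphicE) (rule hom_zero_retract_source[of T V U]; use assms in simp)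

end

section \<open>Orthogonals, the shift, and vanishing of Hom along distinguished triangles\<close>

definition left_perp :: "('o, 'm, 'k, 'e) lin_cat_scheme \<Rightarrow> 'o set \<Rightarrow> 'o set" where
  "left_perp D B = {U \<in> Ob D. \<forall>V \<in> B. Arr D U V = {\<zero>\<^bsub>Hom D U V\<^esub>}}"

definition right_perp :: "('o, 'm, 'k, 'e) lin_cat_scheme \<Rightarrow> 'o set \<Rightarrow> 'o set" where
  "right_perp D A = {V \<in> Ob D. \<forall>U \<in> A. Arr D U V = {\<zero>\<^bsub>Hom D U V\<^esub>}}"

context triangulated_category
begin

lemma shM_zero:
  assumes "U \<in> Ob D" "V \<in> Ob D"
  shows "shM D \<zero>\<^bsub>Hom D U V\<^esub> = \<zero>\<^bsub>Hom D (shO D U) (shO D V)\<^esub>"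
  using shM_add[OF assms zero_in zero_in] assms bij_betw_apply[OF shM_bij]
  by (intro idempotent_imp_zero) (auto simp: shO_in zero_add_zero)

lemma shM_in: "\<lbrakk>U \<in> Ob D; V \<in> Ob D; f \<in> Arr D U V\<rbrakk> \<Longrightarrow> shM D f \<in> Arr D (shO D U) (shO D V)"
  using bij_betw_apply[OF shM_bij] .

lemma hom_zero_shO_iff:
  assumes "U \<in> Ob D" "V \<in> Ob D"
  shows "Arr D (shO D U) (shO D V) = {\<zero>\<^bsub>Hom D (shO D U) (shO D V)\<^esub>} \<longleftrightarrow>
    Arr D U V = {\<zero>\<^bsub>Hom D U V\<^esub>}"
proof -
  have "Arr D (shO D U) (shO D V) = shM D ` Arr D U V"
    using shM_bij[OF assms] by (simp add: bij_betw_def)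
  moreover have "inj_on (shM D) (Arr D U V)"
    using shM_bij[OF assms] by (simp add: bij_betw_def)
  ultimately show ?thesis
    using inj_on_image_eq_iff[of "shM D" "Arr D U V" "Arr D U V" "{\<zero>\<^bsub>Hom D U V\<^esub>}"] assms
    by (simp add: shM_zero[symmetric])
qed

lemma zero_obj_shO: "zero_obj D W \<Longrightarrow> zero_obj D (shO D W)"
  by (rule zero_objI) (auto simp: shO_in zero_obj_def hom_zero_shO_iff)

text \<open>The shift is full, so the two inverse maps lift; it is faithful, so the two identities
  between their composites lift as well.\<close>

lemma isomorphic_shO_imp_isomorphic:
  assumes "U \<in> Ob D" "V \<in> Ob D" "isomorphic D (shO D U) (shO D V)"
  shows "isomorphic D U V"
proof -
  obtain f' g' where f': "f' \<in> Arr D (shO D U) (shO D V)" and g': "g' \<in> Arr D (shO D V) (shO D U)"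
    and gf': "g' \<cdot>\<^bsub>D\<^esub> f' = idm D (shO D U)" and fg': "f' \<cdot>\<^bsub>D\<^esub> g' = idm D (shO D V)"
    using assms(3) by (elim isomorphicE)
  obtain f where f: "f \<in> Arr D U V" "f' = shM D f"
    using f' shM_bij[OF assms(1,2)] by (auto simp: bij_betw_def)
  obtain g where g: "g \<in> Arr D V U" "g' = shM D g"
    using g' shM_bij[OF assms(2,1)] by (auto simp: bij_betw_def)
  have "shM D (g \<cdot>\<^bsub>D\<^esub> f) = shM D (idm D U)" "shM D (f \<cdot>\<^bsub>D\<^esub> g) = shM D (idm D V)"
    using assms f g gf' fg' shM_cmp[of U V U f g] shM_cmp[of V U V g f] by (auto simp: shM_idm)
  then have "g \<cdot>\<^bsub>D\<^esub> f = idm D U" "f \<cdot>\<^bsub>D\<^esub> g = idm D V"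
    using assms f(1) g(1) shM_bij[of U U] shM_bij[of V V]
    by (auto simp: bij_betw_def inj_on_eq_iff cmp_in idm_in)
  then show ?thesis
    using assms f g unfolding isomorphic_def iso_arr_def by blast
qed

lemma tri_rotate:
  assumes "(U, V, W, f, g, h) \<in> tri D"
  shows "(V, W, shO D U, g, h, \<ominus>\<^bsub>Hom D (shO D U) (shO D V)\<^esub> shM D f) \<in> tri D"
  using TR2 tri_typed[OF assms] assms by blast

text \<open>This is the rotated identity triangle of \<open>U\<close>. It is the source of the map
  of triangles that controls maps into a middle term, and it exhibits a zero object as an extension
  of \<open>shO D U\<close> by \<open>U\<close>.\<close>

lemma zero_middle_tri:
  assumes "U \<in> Ob D" "zero_obj D W"
  shows "(U, W, shO D U, \<zero>\<^bsub>Hom D U W\<^esub>, \<zero>\<^bsub>Hom D W (shO D U)\<^esub>,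
    \<ominus>\<^bsub>Hom D (shO D U) (shO D U)\<^esub> idm D (shO D U)) \<in> tri D"
  using tri_rotate[OF TR1_id[OF assms]] assms by (simp add: shM_idm)

text \<open>\<open>TR2\<close> is read backwards. The identity triangle of \<open>U\<close> is
  therefore taken with \<open>shO D W\<close> as its zero object, so that rotating back gives
  \<open>W\<close> as the first term.\<close>

lemma zero_first_tri:
  assumes "U \<in> Ob D" "zero_obj D W"
  shows "(W, U, U, \<zero>\<^bsub>Hom D W U\<^esub>, idm D U, \<zero>\<^bsub>Hom D U (shO D W)\<^esub>) \<in> tri D"
proof -
  have W: "W \<in> Ob D" using assms(2) by (simp add: zero_obj_def)
  have zW: "zero_obj D (shO D W)" using assms(2) by (rule zero_obj_shO)
  interpret M: abelian_group "Hom D (shO D W) (shO D U)"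
    using Hom_abelian_group assms(1) W shO_in by blast
  have "\<ominus>\<^bsub>Hom D (shO D W) (shO D U)\<^esub> shM D \<zero>\<^bsub>Hom D W U\<^esub> = \<zero>\<^bsub>Hom D (shO D W) (shO D U)\<^esub>"
    using assms W by (simp add: shM_zero)
  then show ?thesis
    using TR1_id[OF assms(1) zW] assms W by (subst TR2) (auto simp: shO_in idm_in)
qed

text \<open>The third term is a weak cokernel of \<open>f\<close>: since \<open>a\<close> kills
  \<open>f\<close>, it extends to a map into the triangle with terms \<open>Z\<close>,
  \<open>T\<close>, \<open>T\<close>, and \<open>TR3\<close> supplies the third component.\<close>

lemma factor_through_third:
  assumes t: "(U, V, W, f, g, h) \<in> tri D" and T: "T \<in> Ob D"
    and a: "a \<in> Arr D V T" "a \<cdot>\<^bsub>D\<^esub> f = \<zero>\<^bsub>Hom D U T\<^esub>"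
  obtains c where "c \<in> Arr D W T" "c \<cdot>\<^bsub>D\<^esub> g = a"
proof -
  obtain Z where Z: "zero_obj D Z" using zero_obj_exists by blast
  note ty = tri_typed[OF t]
  have "Z \<in> Ob D" using Z by (simp add: zero_obj_def)
  with ty T a have "\<exists>c \<in> Arr D W T. c \<cdot>\<^bsub>D\<^esub> g = idm D T \<cdot>\<^bsub>D\<^esub> a \<and>
      shM D \<zero>\<^bsub>Hom D U Z\<^esub> \<cdot>\<^bsub>D\<^esub> h = \<zero>\<^bsub>Hom D T (shO D Z)\<^esub> \<cdot>\<^bsub>D\<^esub> c"
    by (intro TR3[OF t zero_first_tri[OF T Z]]) (auto simp: cmp_zero_right)
  then show ?thesis using that ty T a by (auto simp: cmp_idm_left)
qed

text \<open>This is exactness of Hom(\<open>T\<close>, -) at \<open>V\<close>. As \<open>TR3\<close>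
  completes only a third component, the factorization through \<open>U\<close> is found one shift
  higher, on the rotated triangle, and brought back by faithfulness of the shift.\<close>

lemma hom_zero_into_middle:
  assumes t: "(U, V, W, f, g, h) \<in> tri D" and T: "T \<in> Ob D"
    and zU: "Arr D T U = {\<zero>\<^bsub>Hom D T U\<^esub>}" and zW: "Arr D T W = {\<zero>\<^bsub>Hom D T W\<^esub>}"
  shows "Arr D T V = {\<zero>\<^bsub>Hom D T V\<^esub>}"
proof (rule hom_zeroI)
  obtain Z where Z: "zero_obj D Z" using zero_obj_exists by blast
  note ty = tri_typed[OF t]
  have ZO: "Z \<in> Ob D" using Z by (simp add: zero_obj_def)
  fix a assume a: "a \<in> Arr D T V"
  have ga: "g \<cdot>\<^bsub>D\<^esub> a = \<zero>\<^bsub>Hom D T W\<^esub>" using cmp_in[of T V W a g] ty T a zW by blast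
  interpret UV: abelian_group "Hom D (shO D U) (shO D V)"
    using Hom_abelian_group ty shO_in by blast
  interpret TV: abelian_group "Hom D (shO D T) (shO D V)"
    using Hom_abelian_group ty T shO_in by blast
  \<comment> \<open>The triangle with terms \<open>T\<close>, \<open>Z\<close>,
    \<open>shO D T\<close> maps to the rotation of the given one by \<open>a\<close> and zero; the
    first square commutes because of \<open>ga\<close>. The equation \<open>eq\<close> is the last
    square, and up to sign it factors \<open>shM D a\<close> through \<open>shM D f\<close>.\<close>
  obtain c where c: "c \<in> Arr D (shO D T) (shO D U)"
    and eq: "shM D a \<cdot>\<^bsub>D\<^esub> (\<ominus>\<^bsub>Hom D (shO D T) (shO D T)\<^esub> idm D (shO D T)) =
      (\<ominus>\<^bsub>Hom D (shO D U) (shO D V)\<^esub> shM D f) \<cdot>\<^bsub>D\<^esub> c"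
    using TR3[OF zero_middle_tri[OF T Z] tri_rotate[OF t] a zero_in[of Z W]] ty T ZO ga
    by (auto simp: cmp_zero_right)
  have "c = \<zero>\<^bsub>Hom D (shO D T) (shO D U)\<^esub>"
    using c zU hom_zero_shO_iff[of T U] T ty by blast
  then have "(\<ominus>\<^bsub>Hom D (shO D U) (shO D V)\<^esub> shM D f) \<cdot>\<^bsub>D\<^esub> c = \<zero>\<^bsub>Hom D (shO D T) (shO D V)\<^esub>"
    using T ty UV.a_inv_closed[OF shM_in[of U V f]] by (simp add: cmp_zero_right shO_in)
  moreover have "shM D a \<cdot>\<^bsub>D\<^esub> (\<ominus>\<^bsub>Hom D (shO D T) (shO D T)\<^esub> idm D (shO D T)) =
      \<ominus>\<^bsub>Hom D (shO D T) (shO D V)\<^esub> shM D a"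
    using T ty a
      cmp_minus_right[of "shO D T" "shO D T" "shO D V" "idm D (shO D T)" "shM D a"]
      cmp_idm_right[of "shO D T" "shO D V" "shM D a"]
    by (simp add: shO_in shM_in idm_in)
  ultimately have "\<ominus>\<^bsub>Hom D (shO D T) (shO D V)\<^esub> shM D a = \<zero>\<^bsub>Hom D (shO D T) (shO D V)\<^esub>"
    using eq by simp
  then have "shM D a = shM D \<zero>\<^bsub>Hom D T V\<^esub>"
    using T ty a by (simp add: shM_zero shM_in)
  then show "a = \<zero>\<^bsub>Hom D T V\<^esub>"
    using T ty a shM_bij[of T V] by (auto simp: bij_betw_def inj_on_eq_iff)
qed (use tri_typed[OF t] T in auto)

text \<open>A map out of \<open>V\<close> that dies on \<open>U\<close> factors through
  \<open>W\<close> directly, so this dual statement takes no rotation.\<close>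

lemma hom_zero_from_middle:
  assumes t: "(U, V, W, f, g, h) \<in> tri D" and T: "T \<in> Ob D"
    and zU: "Arr D U T = {\<zero>\<^bsub>Hom D U T\<^esub>}" and zW: "Arr D W T = {\<zero>\<^bsub>Hom D W T\<^esub>}"
  shows "Arr D V T = {\<zero>\<^bsub>Hom D V T\<^esub>}"
proof (rule hom_zeroI)
  note ty = tri_typed[OF t]
  fix a assume a: "a \<in> Arr D V T"
  have "a \<cdot>\<^bsub>D\<^esub> f = \<zero>\<^bsub>Hom D U T\<^esub>" using cmp_in[of U V T f a] ty T a zU by blast
  then obtain c where "c \<in> Arr D W T" "c \<cdot>\<^bsub>D\<^esub> g = a"
    using factor_through_third[OF t T a] by blast
  then show "a = \<zero>\<^bsub>Hom D V T\<^esub>"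
    using zW ty T by (auto simp: cmp_zero_left)
qed (use tri_typed[OF t] T in auto)

section \<open>Thickness of orthogonals\<close>

lemma shift_closed_preimage:
  assumes "strictly_full D B" "shift_closed D B" "V \<in> B"
  obtains V' where "V' \<in> B" "isomorphic D (shO D V') V"
proof -
  have "V \<in> Ob D" using assms by (auto simp: strictly_full_def)
  then obtain V' where V': "V' \<in> Ob D" "isomorphic D (shO D V') V" using shO_ess_surj by blast
  then have "shO D V' \<in> B" using assms isomorphic_sym by (auto simp: strictly_full_def)
  then show ?thesis using that V' assms by (auto simp: shift_closed_def)
qed

text \<open>Shifts can be moved from an object onto \<open>B\<close>, extensions are handled by
  exactness of Hom, and summands are retracts. Thickness holds although \<open>B\<close> itself need
  be closed neither under extensions nor under summands, so unions of slices are admissible.\<close>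

lemma thick_left_perp:
  assumes sf: "strictly_full D B" and sc: "shift_closed D B"
  shows "thick D (left_perp D B)"
  unfolding thick_def
proof (intro conjI)
  have BO: "B \<subseteq> Ob D" using sf by (simp add: strictly_full_def)
  show "strictly_full D (left_perp D B)"
    using BO hom_zero_isomorphic_source
    by (fastforce simp: strictly_full_def left_perp_def isomorphic_def)
  show "\<forall>W. zero_obj D W \<longrightarrow> W \<in> left_perp D B"
    using BO by (auto simp: zero_obj_def left_perp_def)
  show "shift_closed D (left_perp D B)"
    unfolding shift_closed_def
  proof (intro ballI iffI)
    fix U assume U: "U \<in> Ob D" and L: "shO D U \<in> left_perp D B"
    have "Arr D U V = {\<zero>\<^bsub>Hom D U V\<^esub>}" if "V \<in> B" for V
      using that L U BO sc hom_zero_shO_iff[of U V] by (auto simp: left_perp_def shift_closed_def)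
    then show "U \<in> left_perp D B" using U by (simp add: left_perp_def)
  next
    fix U assume U: "U \<in> Ob D" and L: "U \<in> left_perp D B"
    \<comment> \<open>The shift has no strict inverse, so \<open>V\<close> is replaced by an
      isomorphic \<open>shO D V'\<close> with \<open>V'\<close> in \<open>B\<close>; the shift is
      then cancelled on both sides.\<close>
    have "Arr D (shO D U) V = {\<zero>\<^bsub>Hom D (shO D U) V\<^esub>}" if V: "V \<in> B" for V
    proof -
      obtain V' where V': "V' \<in> B" "isomorphic D (shO D V') V" using shift_closed_preimage[OF sf sc V] .
      then show ?thesis
        using L U BO hom_zero_shO_iff[of U V']
        by (intro hom_zero_isomorphic_target[OF V'(2)]) (auto simp: left_perp_def shO_in)
    qed
    then show "shO D U \<in> left_perp D B" using U by (simp add: left_perp_def shO_in)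
  qed
  show "extension_closed D (left_perp D B)"
    unfolding extension_closed_def
  proof (intro allI impI, elim conjE)
    fix U V W f g h
    assume t: "(U, V, W, f, g, h) \<in> tri D" and "U \<in> left_perp D B" "W \<in> left_perp D B"
    then show "V \<in> left_perp D B"
      using hom_zero_from_middle[OF t] tri_typed[OF t] BO by (auto simp: left_perp_def)
  qed
  show "summand_closed D (left_perp D B)"
    unfolding summand_closed_def
  proof (intro allI impI, elim conjE)
    fix U W V assume "biproduct D U W V" and V: "V \<in> left_perp D B"
    then obtain i p where "U \<in> Ob D" "V \<in> Ob D" "i \<in> Arr D U V" "p \<in> Arr D V U" "p \<cdot>\<^bsub>D\<^esub> i = idm D U"
      unfolding biproduct_def by blast
    then show "U \<in> left_perp D B"
      using hom_zero_retract_source[of _ U V i p] V BO by (auto simp: left_perp_def)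
  qed
qed

text \<open>The dual argument, with exactness of Hom in the second variable.\<close>

lemma thick_right_perp:
  assumes sf: "strictly_full D A" and sc: "shift_closed D A"
  shows "thick D (right_perp D A)"
  unfolding thick_def
proof (intro conjI)
  have AO: "A \<subseteq> Ob D" using sf by (simp add: strictly_full_def)
  show "strictly_full D (right_perp D A)"
    using AO hom_zero_isomorphic_target
    by (fastforce simp: strictly_full_def right_perp_def isomorphic_def)
  show "\<forall>W. zero_obj D W \<longrightarrow> W \<in> right_perp D A"
    using AO by (auto simp: zero_obj_def right_perp_def)
  show "shift_closed D (right_perp D A)"
    unfolding shift_closed_def
  proof (intro ballI iffI)
    fix V assume V: "V \<in> Ob D" and R: "shO D V \<in> right_perp D A"
    have "Arr D U V = {\<zero>\<^bsub>Hom D U V\<^esub>}" if "U \<in> A" for U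
      using that R V AO sc hom_zero_shO_iff[of U V] by (auto simp: right_perp_def shift_closed_def)
    then show "V \<in> right_perp D A" using V by (simp add: right_perp_def)
  next
    fix V assume V: "V \<in> Ob D" and R: "V \<in> right_perp D A"
    have "Arr D U (shO D V) = {\<zero>\<^bsub>Hom D U (shO D V)\<^esub>}" if U: "U \<in> A" for U
    proof -
      obtain U' where U': "U' \<in> A" "isomorphic D (shO D U') U" using shift_closed_preimage[OF sf sc U] .
      then show ?thesis
        using R V AO hom_zero_shO_iff[of U' V]
        by (intro hom_zero_isomorphic_source[OF U'(2)]) (auto simp: right_perp_def shO_in)
    qed
    then show "shO D V \<in> right_perp D A" using V by (simp add: right_perp_def shO_in)
  qed
  show "extension_closed D (right_perp D A)"
    unfolding extension_closed_def
  proof (intro allI impI, elim conjE)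
    fix U V W f g h
    assume t: "(U, V, W, f, g, h) \<in> tri D" and "U \<in> right_perp D A" "W \<in> right_perp D A"
    then show "V \<in> right_perp D A"
      using hom_zero_into_middle[OF t] tri_typed[OF t] AO by (auto simp: right_perp_def)
  qed
  show "summand_closed D (right_perp D A)"
    unfolding summand_closed_def
  proof (intro allI impI, elim conjE)
    fix U W V assume "biproduct D U W V" and V: "V \<in> right_perp D A"
    then obtain i p where "U \<in> Ob D" "V \<in> Ob D" "i \<in> Arr D U V" "p \<in> Arr D V U" "p \<cdot>\<^bsub>D\<^esub> i = idm D U"
      unfolding biproduct_def by blast
    then show "U \<in> right_perp D A"
      using hom_zero_retract_target[of _ U V i p] V AO by (auto simp: right_perp_def)
  qed
qed

section \<open>Thick subcategories, triangles and filtrations\<close>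

lemma thick_extension:
  "\<lbrakk>thick D A; (U, V, W, f, g, h) \<in> tri D; U \<in> A; W \<in> A\<rbrakk> \<Longrightarrow> V \<in> A"
  unfolding thick_def extension_closed_def by blast

text \<open>Rotation places \<open>W\<close> between \<open>V\<close> and \<open>shO D U\<close>, so
  it becomes an extension of objects of \<open>A\<close>.\<close>

lemma thick_third:
  assumes "thick D A" "(U, V, W, f, g, h) \<in> tri D" "U \<in> A" "V \<in> A"
  shows "W \<in> A"
  using thick_extension[OF assms(1) tri_rotate[OF assms(2)] assms(4)] assms tri_typed[OF assms(2)]
  by (auto simp: thick_def shift_closed_def)

lemma thick_first:
  assumes "thick D A" "(U, V, W, f, g, h) \<in> tri D" "V \<in> A" "W \<in> A"
  shows "U \<in> A"
  using thick_third[OF assms(1) tri_rotate[OF assms(2)] assms(3,4)] assms tri_typed[OF assms(2)]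
  by (auto simp: thick_def shift_closed_def)

lemma thick_Int:
  assumes "thick D A" "thick D B"
  shows "thick D (A \<inter> B)"
  unfolding thick_def
proof (intro conjI)
  show "strictly_full D (A \<inter> B)"
    using assms unfolding thick_def strictly_full_def by blast
  show "\<forall>W. zero_obj D W \<longrightarrow> W \<in> A \<inter> B"
    using assms unfolding thick_def by blast
  show "shift_closed D (A \<inter> B)"
    using assms unfolding thick_def shift_closed_def by blast
  show "extension_closed D (A \<inter> B)"
    using assms unfolding thick_def extension_closed_def by blast
  show "summand_closed D (A \<inter> B)"
    using assms unfolding thick_def summand_closed_def by blast
qed

lemma filtration_tri:
  assumes "filtration D \<Phi> P U n Us p A \<phi>" "i \<in> {1..n}"
  obtains g h where "(Us i, Us (i - 1), A i, p i, g, h) \<in> tri D"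
  using assms unfolding filtration_def by blast

text \<open>Induction descends from the zero object \<open>Us n\<close>: each \<open>Us k\<close> is
  an extension of \<open>A (Suc k)\<close> by \<open>Us (Suc k)\<close>. Only the quotients beyond
  \<open>k\<close> matter, so \<open>k = 0\<close> treats the whole object and \<open>k = 1\<close>
  the tail left after splitting off the first quotient.\<close>

lemma filtration_in_thick:
  assumes "thick D T" "filtration D \<Phi> P U n Us p A \<phi>"
    and "k \<le> n" "\<And>i. \<lbrakk>k < i; i \<le> n\<rbrakk> \<Longrightarrow> A i \<in> T"
  shows "Us k \<in> T"
  using assms(3,4)
proof (induction k rule: inc_induct)
  case base
  then show ?case using assms(1,2) by (auto simp: thick_def filtration_def)
next
  case (step k)
  have "Suc k \<in> {1..n}" using step.hyps by simp
  then obtain g h where "(Us (Suc k), Us k, A (Suc k), p (Suc k), g, h) \<in> tri D"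
    using filtration_tri[OF assms(2)] by (metis diff_Suc_1)
  then show ?case using step thick_extension[OF assms(1)] by simp
qed

end

section \<open>Slices of a finite t-stability\<close>

lemma shift_automorphism_finite_id:
  assumes "shift_automorphism D \<Phi> P \<tau>" "finite \<Phi>" "\<phi> \<in> \<Phi>"
  shows "\<tau> \<phi> = \<phi>"
proof (rule ccontr)
  assume "\<tau> \<phi> \<noteq> \<phi>"
  let ?M = "{\<psi> \<in> \<Phi>. \<tau> \<psi> \<noteq> \<psi>}"
  have fin: "finite ?M" "?M \<noteq> {}" using assms(2,3) \<open>\<tau> \<phi> \<noteq> \<phi>\<close> by auto
  \<comment> \<open>The largest index moved by \<open>\<tau>\<close>. Its image is larger, and by
    injectivity is moved too, contradicting maximality.\<close>
  define m where "m = Max ?M"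
  have m: "m \<in> ?M" using Max_in[OF fin] m_def by simp
  have bij: "bij_betw \<tau> \<Phi> \<Phi>" and ge: "\<And>\<psi>. \<psi> \<in> \<Phi> \<Longrightarrow> \<psi> \<le> \<tau> \<psi>"
    using assms(1) by (auto simp: shift_automorphism_def)
  have "\<tau> m \<in> \<Phi>" using m bij bij_betw_apply by fastforce
  moreover have "\<tau> (\<tau> m) \<noteq> \<tau> m"
    using m bij \<open>\<tau> m \<in> \<Phi>\<close> by (auto simp: bij_betw_def inj_on_eq_iff)
  ultimately have "\<tau> m \<le> m" using fin(1) m_def by (intro Max_ge[of ?M, folded m_def]) auto
  then show False using ge m by force
qed

locale finite_stability = triangulated_category K D
  for K :: "('k, 'a) ring_scheme" (structure) and D :: "('o, 'm, 'k, 'e) tri_cat_scheme" +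
  fixes \<Phi> :: "'i::linorder set" and P :: "'i \<Rightarrow> 'o set"
  assumes stab: "finite_t_stability D \<Phi> P"
begin

lemma slice_strictly_full: "\<phi> \<in> \<Phi> \<Longrightarrow> strictly_full D (P \<phi>)"
  and slice_extension_closed: "\<phi> \<in> \<Phi> \<Longrightarrow> extension_closed D (P \<phi>)"
  and slice_nonzero: "\<phi> \<in> \<Phi> \<Longrightarrow> \<exists>U \<in> P \<phi>. \<not> zero_obj D U"
  using stab by (auto simp: finite_t_stability_def t_stability_def)

lemma slice_Ob: "\<lbrakk>\<phi> \<in> \<Phi>; U \<in> P \<phi>\<rbrakk> \<Longrightarrow> U \<in> Ob D"
  using slice_strictly_full by (auto simp: strictly_full_def)

lemma slice_hom_zero:
  assumes "\<phi>' \<in> \<Phi>" "\<phi>'' \<in> \<Phi>" "\<phi>'' < \<phi>'" "U \<in> P \<phi>'" "V \<in> P \<phi>''"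
  shows "Arr D U V = {\<zero>\<^bsub>Hom D U V\<^esub>}"
proof -
  have "Arr D U (shift D 0 V) = {\<zero>\<^bsub>Hom D U (shift D 0 V)\<^esub>}"
    using stab assms unfolding finite_t_stability_def t_stability_def by blast
  then show ?thesis by (simp add: shift_def)
qed

text \<open>The automorphism is the identity, so the slice equals its own shift, closed under
  isomorphism. Passing from \<open>shO D U\<close> back to \<open>U\<close> uses that the shift
  reflects isomorphism.\<close>

lemma slice_shift_closed:
  assumes "\<phi> \<in> \<Phi>"
  shows "shift_closed D (P \<phi>)"
proof -
  obtain \<tau> where \<tau>: "shift_automorphism D \<Phi> P \<tau>" and "finite \<Phi>"
    using stab by (auto simp: finite_t_stability_def t_stability_def)
  then have "\<tau> \<phi> = \<phi>" using shift_automorphism_finite_id assms by blast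
  then have eq: "P \<phi> = shift_subcat D (P \<phi>)" using \<tau> assms by (force simp: shift_automorphism_def)
  show ?thesis
    unfolding shift_closed_def
  proof (intro ballI iffI)
    fix U assume U: "U \<in> Ob D" "shO D U \<in> P \<phi>"
    then obtain U' where U': "U' \<in> P \<phi>" "isomorphic D (shO D U') (shO D U)"
      using eq by (auto simp: shift_subcat_def)
    then have "isomorphic D U' U"
      using isomorphic_shO_imp_isomorphic slice_Ob[OF assms] U by blast
    then show "U \<in> P \<phi>" using U' slice_strictly_full[OF assms] by (auto simp: strictly_full_def)
  next
    fix U assume U: "U \<in> Ob D" "U \<in> P \<phi>"
    have "iso_arr D (shO D U) (shO D U) (idm D (shO D U))"
      unfolding iso_arr_def using idm_in cmp_idm_left shO_in U by blast
    then have "isomorphic D (shO D U) (shO D U)" using U shO_in by (auto simp: isomorphic_def)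
    then show "shO D U \<in> P \<phi>" using U eq by (auto simp: shift_subcat_def)
  qed
qed

lemma slice_zero_obj:
  assumes "\<phi> \<in> \<Phi>" "zero_obj D W"
  shows "W \<in> P \<phi>"
proof -
  obtain U where U: "U \<in> P \<phi>" using slice_nonzero[OF assms(1)] by blast
  then have "U \<in> Ob D" using slice_Ob assms(1) by blast
  then show ?thesis
    using zero_middle_tri[OF _ assms(2)] U slice_shift_closed[OF assms(1)]
      slice_extension_closed[OF assms(1)]
    unfolding shift_closed_def extension_closed_def by blast
qed

lemma strictly_full_UN: "I \<subseteq> \<Phi> \<Longrightarrow> strictly_full D (\<Union>\<phi>\<in>I. P \<phi>)"
  using slice_strictly_full unfolding strictly_full_def by blast

lemma shift_closed_UN: "I \<subseteq> \<Phi> \<Longrightarrow> shift_closed D (\<Union>\<phi>\<in>I. P \<phi>)"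
  using slice_shift_closed unfolding shift_closed_def by blast

abbreviation lower :: "'i \<Rightarrow> 'o set" where
  "lower \<phi> \<equiv> \<Union>\<psi> \<in> {\<psi> \<in> \<Phi>. \<psi> < \<phi>}. P \<psi>"

abbreviation upper :: "'i \<Rightarrow> 'o set" where
  "upper \<phi> \<equiv> \<Union>\<psi> \<in> {\<psi> \<in> \<Phi>. \<phi> < \<psi>}. P \<psi>"

lemma thick_left_perp_lower: "thick D (left_perp D (lower \<phi>))"
  by (intro thick_left_perp strictly_full_UN shift_closed_UN) auto

lemma thick_right_perp_upper: "thick D (right_perp D (upper \<phi>))"
  by (intro thick_right_perp strictly_full_UN shift_closed_UN) auto

lemma slice_subset_perps:
  "\<phi> \<in> \<Phi> \<Longrightarrow> P \<phi> \<subseteq> left_perp D (lower \<phi>) \<inter> right_perp D (upper \<phi>)"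
  using slice_Ob slice_hom_zero by (auto simp: left_perp_def right_perp_def)

text \<open>The first quotient \<open>A 1\<close> has the smallest index in the filtration. An index
  below or above \<open>\<phi>\<close> forces \<open>A 1\<close> or \<open>U\<close> to vanish; if
  it equals \<open>\<phi>\<close>, the tail \<open>Us 1\<close> vanishes and \<open>U\<close> is an
  extension of \<open>A 1\<close> by a zero object.\<close>

lemma perps_subset_slice:
  assumes \<phi>: "\<phi> \<in> \<Phi>"
  shows "left_perp D (lower \<phi>) \<inter> right_perp D (upper \<phi>) \<subseteq> P \<phi>"
proof
  fix U assume "U \<in> left_perp D (lower \<phi>) \<inter> right_perp D (upper \<phi>)"
  then have UL: "U \<in> left_perp D (lower \<phi>)" and UR: "U \<in> right_perp D (upper \<phi>)" by auto
  have UO: "U \<in> Ob D" using UL by (simp add: left_perp_def)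
  show "U \<in> P \<phi>"
  proof (cases "zero_obj D U")
    case True
    then show ?thesis using slice_zero_obj[OF \<phi>] by blast
  next
    case False
    obtain n Us p A \<psi> where fil: "filtration D \<Phi> P U n Us p A \<psi>"
      using stab UO False unfolding finite_t_stability_def t_stability_def by blast
    have n: "1 \<le> n"
    proof (rule ccontr)
      assume "\<not> 1 \<le> n"
      then have "n = 0" by simp
      then show False using fil False by (auto simp: filtration_def)
    qed
    have U0: "Us 0 = U" using fil by (simp add: filtration_def)
    have A: "\<And>i. \<lbrakk>1 \<le> i; i \<le> n\<rbrakk> \<Longrightarrow> \<not> zero_obj D (A i) \<and> \<psi> i \<in> \<Phi> \<and> A i \<in> P (\<psi> i)"
      using fil by (auto simp: filtration_def)
    obtain g h where t: "(Us 1, U, A 1, p 1, g, h) \<in> tri D"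
      using filtration_tri[OF fil, of 1] n U0 by auto
    have A1: "\<not> zero_obj D (A 1)" "\<psi> 1 \<in> \<Phi>" "A 1 \<in> P (\<psi> 1)" using A n by auto
    have mono: "\<psi> 1 < \<psi> i" if "1 < i" "i \<le> n" for i
      using that
    proof (induction i)
      case 0
      then show ?case by simp
    next
      case (Suc i)
      then have "\<psi> i < \<psi> (Suc i)" using fil by (simp add: filtration_def)
      then show ?case using Suc by (cases "i = 1") auto
    qed
    \<comment> \<open>A double orthogonal: a thick subcategory containing all slices above
      \<open>\<phi>\<close>. An object of \<open>L\<close> that is also right orthogonal to those
      slices is orthogonal to itself, hence zero.\<close>
    define L where "L = left_perp D (right_perp D (upper \<phi>))"
    have thL: "thick D L" unfolding L_def
      using thick_right_perp_upper[of \<phi>] by (intro thick_left_perp) (auto simp: thick_def)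
    have in_L: "V \<in> L" if "\<theta> \<in> \<Phi>" "\<phi> < \<theta>" "V \<in> P \<theta>" for V \<theta>
      using that slice_Ob by (auto simp: L_def left_perp_def right_perp_def)
    have zero: "zero_obj D V" if "V \<in> L" "V \<in> right_perp D (upper \<phi>)" for V
      using that by (intro zero_objI) (auto simp: L_def left_perp_def)
    consider "\<psi> 1 < \<phi>" | "\<phi> < \<psi> 1" | "\<psi> 1 = \<phi>" by force
    then show ?thesis
    proof cases
      case 1 \<comment> \<open>\<open>U\<close> and \<open>Us 1\<close> are left orthogonal to \<open>P (\<psi> 1)\<close>, hence so is \<open>A 1\<close>, which is then zero.\<close>
      define M where "M = left_perp D (P (\<psi> 1))"
      have thM: "thick D M" unfolding M_def
        using A1 slice_strictly_full slice_shift_closed by (intro thick_left_perp)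
      have "A i \<in> M" if "1 < i" "i \<le> n" for i
        unfolding M_def left_perp_def using mono[OF that] that A[of i] A1 slice_Ob slice_hom_zero by auto
      then have "Us 1 \<in> M" using filtration_in_thick[OF thM fil n] by blast
      moreover have "U \<in> M" using UL 1 A1 by (auto simp: M_def left_perp_def)
      ultimately have "A 1 \<in> M" using thick_third[OF thM t] by blast
      then have "zero_obj D (A 1)" using A1 by (intro zero_objI) (auto simp: M_def left_perp_def)
      then show ?thesis using A1 by blast
    next
      case 2
      \<comment> \<open>All quotients lie above \<open>\<phi>\<close>, so \<open>U\<close> belongs
        to \<open>L\<close> and to the right orthogonal at once.\<close>
      have "A i \<in> L" if "0 < i" "i \<le> n" for i
        using that A[of i] 2 mono[of i] in_L[of "\<psi> i" "A i"] by (cases "i = 1") auto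
      then have "U \<in> L" using filtration_in_thick[OF thL fil, of 0] U0 by auto
      then show ?thesis using zero UR False by blast
    next
      case 3
      \<comment> \<open>All quotients except the first lie above \<open>\<phi>\<close>, so the tail
        \<open>Us 1\<close> is in \<open>L\<close>; being the first term of a triangle whose other
        terms are \<open>U\<close> and \<open>A 1\<close>, it is in the right orthogonal
        too.\<close>
      have "A i \<in> L" if "1 < i" "i \<le> n" for i
        using that A[of i] 3 mono[of i] in_L[of "\<psi> i" "A i"] by auto
      then have "Us 1 \<in> L" using filtration_in_thick[OF thL fil n] by blast
      moreover have "A 1 \<in> right_perp D (upper \<phi>)" using A1 3 slice_subset_perps[OF \<phi>] by auto
      then have "Us 1 \<in> right_perp D (upper \<phi>)"
        using thick_first[OF thick_right_perp_upper t UR] by blast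
      ultimately have "Us 1 \<in> P \<phi>" using zero slice_zero_obj[OF \<phi>] by blast
      then show ?thesis
        using t A1 3 slice_extension_closed[OF \<phi>] unfolding extension_closed_def by blast
    qed
  qed
qed

text \<open>Summand closure is not among the axioms for a slice; it is inherited from the two
  orthogonals.\<close>

lemma thick_slice:
  assumes "\<phi> \<in> \<Phi>"
  shows "thick D (P \<phi>)"
proof -
  have "P \<phi> = left_perp D (lower \<phi>) \<inter> right_perp D (upper \<phi>)"
    using slice_subset_perps perps_subset_slice assms by blast
  then show ?thesis using thick_Int thick_left_perp_lower thick_right_perp_upper by metis
qed

lemma generated_slice: "\<phi> \<in> \<Phi> \<Longrightarrow> generated D (P \<phi>) = P \<phi>"
  unfolding generated_def using thick_slice by (rule hull_same)

lemma generated_subset_slice: "\<lbrakk>\<phi> \<in> \<Phi>; S \<subseteq> P \<phi>\<rbrakk> \<Longrightarrow> generated D S \<subseteq> P \<phi>"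
  unfolding generated_def using thick_slice by (intro hull_minimal)

end

section \<open>Refinements under the Hom condition\<close>

theorem proposition3p8:
  fixes K :: "('k, 'a) ring_scheme"
    and D :: "('o, 'm, 'k, 'e) tri_cat_scheme"
    and n :: nat
    and P :: "nat \<Rightarrow> 'o set"
  assumes "triangulated_category K D"
    and "finite_t_stability D {1..n} P"
    and "\<And>i U V. \<lbrakk>i \<in> {1..n}; U \<in> P i; V \<in> P i; \<not> zero_obj D U; \<not> zero_obj D V\<rbrakk>
      \<Longrightarrow> Hom_nonzero D (generated D {U}) (generated D {V}) \<and>
          Hom_nonzero D (generated D {V}) (generated D {U})"
  shows "finite_finest D {1..n} P"
  unfolding finite_finest_def
proof (intro conjI allI impI)
  show "finite_t_stability D {1..n} P" by (rule assms(2))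
next
  fix \<Psi> :: "nat set" and Q
  assume "finite_t_stability D \<Psi> Q \<and> finer D \<Psi> Q {1..n} P"
  then have stabQ: "finite_t_stability D \<Psi> Q" and fin: "finer D \<Psi> Q {1..n} P" by auto
  \<comment> \<open>The structure results are applied to the refinement: its slices have to be thick
    in order to contain the subcategories generated by their objects.\<close>
  interpret Q: finite_stability K D \<Psi> Q
    using assms(1) stabQ by (intro finite_stability.intro finite_stability_axioms.intro)
  obtain r where im: "r ` \<Psi> = {1..n}"
    and mono: "\<forall>\<psi>' \<in> \<Psi>. \<forall>\<psi>'' \<in> \<Psi>. \<psi>' > \<psi>'' \<longrightarrow> r \<psi>' \<ge> r \<psi>''"
    and all: "\<forall>i \<in> {1..n}. P i = generated D (\<Union>\<psi> \<in> {\<psi> \<in> \<Psi>. r \<psi> = i}. Q \<psi>)"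
    using fin unfolding finer_def by (elim exE conjE, intro that) assumption+
  have gen: "P i = generated D (\<Union>\<psi> \<in> {\<psi> \<in> \<Psi>. r \<psi> = i}. Q \<psi>)" if "i \<in> {1..n}" for i
    using all that by (rule bspec)
  have r_in: "r \<psi> \<in> {1..n}" if "\<psi> \<in> \<Psi>" for \<psi>
    using that unfolding im[symmetric] by (rule imageI)
  have QP: "U \<in> P (r \<psi>)" if "\<psi> \<in> \<Psi>" "U \<in> Q \<psi>" for \<psi> U
  proof -
    have "U \<in> (\<Union>\<psi>' \<in> {\<psi>' \<in> \<Psi>. r \<psi>' = r \<psi>}. Q \<psi>')"
      using that by blast
    then show ?thesis
      unfolding gen[OF r_in[OF that(1)]] generated_def using hull_subset by (rule rev_subsetD)
  qed
  have "inj_on r \<Psi>"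
  proof (rule linorder_inj_onI)
    fix \<psi>'' \<psi>' assume lt: "\<psi>'' < \<psi>'" and mem: "\<psi>'' \<in> \<Psi>" "\<psi>' \<in> \<Psi>"
    obtain U V where U: "U \<in> Q \<psi>'" "\<not> zero_obj D U" and V: "V \<in> Q \<psi>''" "\<not> zero_obj D V"
      using Q.slice_nonzero mem by blast
    have "generated D {U} \<subseteq> Q \<psi>'" "generated D {V} \<subseteq> Q \<psi>''"
      using Q.generated_subset_slice mem U V by simp_all
    then have "\<not> Hom_nonzero D (generated D {U}) (generated D {V})"
      using Q.slice_hom_zero[OF mem(2,1) lt] unfolding Hom_nonzero_def by blast
    \<comment> \<open>The direction matters: \<open>U\<close> is from the higher slice and
      \<open>V\<close> from the lower, and Hom vanishes from higher to lower. If the indices had the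
      same image, both objects would lie in one \<open>P i\<close>, where the hypothesis makes this
      Hom nonzero.\<close>
    moreover have "Hom_nonzero D (generated D {U}) (generated D {V})" if "r \<psi>'' = r \<psi>'"
      using assms(3)[OF r_in[OF mem(2)] QP[OF mem(2) U(1)] _ U(2) V(2)] QP[OF mem(1) V(1)] that
      by simp
    ultimately show "r \<psi>'' \<noteq> r \<psi>'" by blast
  qed auto
  moreover have "mono_on \<Psi> r"
    using mono by (auto simp: mono_on_def le_less)
  moreover have "P (r \<psi>) = Q \<psi>" if "\<psi> \<in> \<Psi>" for \<psi>
  proof -
    have "{\<psi>' \<in> \<Psi>. r \<psi>' = r \<psi>} = {\<psi>}"
      using \<open>inj_on r \<Psi>\<close> that by (auto simp: inj_on_eq_iff)
    \<comment> \<open>With a one-element fibre, \<open>P (r \<psi>)\<close> is generated by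
      \<open>Q \<psi>\<close> alone, which is already thick.\<close>
    then show ?thesis using gen[OF r_in[OF that]] Q.generated_slice[OF that] by simp
  qed
  ultimately show "t_stability_equiv \<Psi> Q {1..n} P"
    unfolding t_stability_equiv_def bij_betw_def using im by blast
qed

end
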